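(* Consider the adaptive two-stage newsvendor problem with given revision time $t^*\in\{1,\dots,T\}$, $$\min_{x_1,\dots,x_{t^*-1}\in\mathbb{R}_+}\Big\{\sum_{t=1}^{t^*-1}\Big(c_tx_t+\mathbb{E}\big[h_t\max\{\textstyle\sum_{t'=1}^{t}(x_{t'}-d_{t'}),0\}-b_t\min\{\sum_{t'=1}^{t}(x_{t'}-d_{t'}),0\}\big]\Big)+\mathbb{E}\big[Q_{t^*}(\textstyle\sum_{t=1}^{t^*-1}(x_t-d_t))\big]\Big\},$$ where $$Q_{t^*}(s)=\min_{x_{t^*},\dots,x_T\in\mathbb{R}_+}\Big\{\sum_{t=t^*}^{T}\Big(c_tx_t+\mathbb{E}\big[h_t\max\{s+\textstyle\sum_{t'=t^*}^{t}(x_{t'}-d_{t'}),0\}-b_t\min\{s+\sum_{t'=t^*}^{t}(x_{t'}-d_{t'}),0\}\big]\Big)\Big\}.$$ Then the (optimal) order quantities can be represented by order-up-to levels $X_{1,t}$ ($t=1,\dots,t^*-1$) and $X_{t^*,t}$ ($t=t^*,\dots,T$) satisfying $$\widetilde F_{1,t}(X_{1,t})=\frac{-c_t+c_{t+1}+b_t}{h_t+b_t},\qquad t=1,\dots,t^*-1,$$ $$\widetilde F_{t^*,t}(s_{t^*}+X_{t^*,t})=\frac{-c_t+c_{t+1}+b_t}{h_t+b_t},\qquad t=t^*,\dots,T,$$ where $c_{T+1}=0$ and $s_{t^*}$ is the inventory level at time $t^*$.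
   Context: There are $T$ periods. $x_t\ge 0$ is the order amount in period $t$; $d_t$ is the demand in period $t$, assumed random except for $d_1$, which is given. Unit ordering cost in period $t$ is $c_t$, unit holding cost at the end of period $t$ is $h_t$, unit backorder cost is $b_t$ (stockouts are backordered); initial inventory is zero. It is assumed that $c_t-b_t\le c_{t+1}\le c_t+h_t$ for $t=1,\dots,T-1$ and $b_T\ge c_T$. $D_{i,j}=\sum_{t=i}^{j}d_t$ and $\widetilde F_{i,j}$ is the cumulative distribution function of $D_{i,j}$. In the adaptive two-stage problem, the orders $x_1,\dots,x_{t^*-1}$ are fixed at the beginning of planning; at time $t^*$ the net inventory $s_{t^*}=\sum_{t=1}^{t^*-1}(x_t-d_t)$ is observed and then $x_{t^*},\dots,x_T$ are fixed. $X_{i,j}$ denotes the order-up-to level from period $i$ to period $j$ (a target for the cumulative order quantity of periods $i,\dots,j$). The order quantities corresponding to the levels are: $x_1=X_{1,1}$ and $x_t=\max\{X_{1,t}-\sum_{t'=1}^{t-1}x_{t'},0\}$ for $t=2,\dots,t^*-1$; $x_{t^*}=\max\{X_{t^*,t^*},0\}$ and $x_t=\max\{X_{t^*,t}-\sum_{t'=t^*}^{t-1}x_{t'},0\}$ for $t=t^*+1,\dots,T$.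
   Formalization: Assumes integrable demands, h_t+b_t>0, and that levels exist, are nondecreasing in t within each stage, and, if t*>1, that X_{1,1}≥0 and X_{t*,t*}≥0 a.s. at s_{t*}; F(X)=p is read as F(X-)≤p≤F(X), as d_1 is given. *)

theory Defs
  imports "HOL-Probability.Probability"
begin

definition demand_sum :: "(nat \<Rightarrow> 'a \<Rightarrow> real) \<Rightarrow> nat \<Rightarrow> nat \<Rightarrow> 'a \<Rightarrow> real" where
  "demand_sum d i j \<omega> = (\<Sum>t=i..j. d t \<omega>)"

definition demand_law :: "'a measure \<Rightarrow> (nat \<Rightarrow> 'a \<Rightarrow> real) \<Rightarrow> nat \<Rightarrow> nat \<Rightarrow> real measure" where
  "demand_law M d i j = distr M borel (demand_sum d i j)"

definition net_inventory :: "(nat \<Rightarrow> 'a \<Rightarrow> real) \<Rightarrow> (nat \<Rightarrow> real) \<Rightarrow> nat \<Rightarrow> nat \<Rightarrow> 'a \<Rightarrow> real" where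
  "net_inventory d x i j \<omega> = (\<Sum>t=i..j. x t - d t \<omega>)"

definition inventory_cost :: "real \<Rightarrow> real \<Rightarrow> real \<Rightarrow> real" where
  "inventory_cost h b y = h * max y 0 - b * min y 0"

definition nonneg_orders :: "nat set \<Rightarrow> (nat \<Rightarrow> real) \<Rightarrow> bool" where
  "nonneg_orders A x \<longleftrightarrow> (\<forall>t\<in>A. 0 \<le> x t)"

text \<open>The revision time is \<open>r\<close>. Order plans are functions on all of \<open>nat\<close>, but a stage objective
  only looks at the periods of its own stage. The expectation in the second stage is taken for a
  fixed number \<open>s\<close>; it is not conditioned on the demands before period \<open>r\<close>.\<close>

definition second_stage_cost ::
  "'a measure \<Rightarrow> nat \<Rightarrow> nat \<Rightarrow> (nat \<Rightarrow> real) \<Rightarrow> (nat \<Rightarrow> real) \<Rightarrow> (nat \<Rightarrow> real) \<Rightarrow>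
    (nat \<Rightarrow> 'a \<Rightarrow> real) \<Rightarrow> real \<Rightarrow> (nat \<Rightarrow> real) \<Rightarrow> real" where
  "second_stage_cost M T r c h b d s x =
     (\<Sum>t=r..T. c t * x t +
        (\<integral>\<omega>. inventory_cost (h t) (b t) (s + net_inventory d x r t \<omega>) \<partial>M))"

definition second_stage_value ::
  "'a measure \<Rightarrow> nat \<Rightarrow> nat \<Rightarrow> (nat \<Rightarrow> real) \<Rightarrow> (nat \<Rightarrow> real) \<Rightarrow> (nat \<Rightarrow> real) \<Rightarrow>
    (nat \<Rightarrow> 'a \<Rightarrow> real) \<Rightarrow> real \<Rightarrow> real" where
  "second_stage_value M T r c h b d s =
     (INF x\<in>{x. nonneg_orders {r..T} x}. second_stage_cost M T r c h b d s x)"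

definition first_stage_cost ::
  "'a measure \<Rightarrow> nat \<Rightarrow> nat \<Rightarrow> (nat \<Rightarrow> real) \<Rightarrow> (nat \<Rightarrow> real) \<Rightarrow> (nat \<Rightarrow> real) \<Rightarrow>
    (nat \<Rightarrow> 'a \<Rightarrow> real) \<Rightarrow> (nat \<Rightarrow> real) \<Rightarrow> real" where
  "first_stage_cost M T r c h b d x =
     (\<Sum>t=1..r-1. c t * x t +
        (\<integral>\<omega>. inventory_cost (h t) (b t) (net_inventory d x 1 t \<omega>) \<partial>M)) +
     (\<integral>\<omega>. second_stage_value M T r c h b d (net_inventory d x 1 (r - 1) \<omega>) \<partial>M)"

fun first_stage_orders :: "(nat \<Rightarrow> real) \<Rightarrow> nat \<Rightarrow> real" where
  "first_stage_orders X t =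
     (if t \<le> 1 then X 1 else max (X t - (\<Sum>u=1..<t. first_stage_orders X u)) 0)"

fun second_stage_orders :: "nat \<Rightarrow> (nat \<Rightarrow> real) \<Rightarrow> nat \<Rightarrow> real" where
  "second_stage_orders r X t =
     (if t \<le> r then max (X r) 0 else max (X t - (\<Sum>u=r..<t. second_stage_orders r X u)) 0)"

declare first_stage_orders.simps [simp del] second_stage_orders.simps [simp del]

definition critical_ratio ::
  "(nat \<Rightarrow> real) \<Rightarrow> (nat \<Rightarrow> real) \<Rightarrow> (nat \<Rightarrow> real) \<Rightarrow> nat \<Rightarrow> real" where
  "critical_ratio c h b t = (- c t + c (t + 1) + b t) / (h t + b t)"

text \<open>The equation \<open>F x = p\<close> for a distribution function \<open>F\<close> that may jump: \<open>F\<close> passes through the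
  level \<open>p\<close> at \<open>x\<close>, i.e. \<open>F(x-) \<le> p \<le> F(x)\<close>. A given demand has a step function as its distribution
  function, which takes no value strictly between 0 and 1, so the literal equation would be
  unsolvable there. The lemmas below relate the notion to the literal equation: that equation
  always implies it, and the two agree wherever \<open>F\<close> is continuous.\<close>

definition solves_cdf_eq :: "real measure \<Rightarrow> real \<Rightarrow> real \<Rightarrow> bool" where
  "solves_cdf_eq N p x \<longleftrightarrow> measure N {..<x} \<le> p \<and> p \<le> cdf N x"

lemma solves_cdf_eqI:
  assumes "real_distribution N" and "cdf N x = p"
  shows "solves_cdf_eq N p x"
proof -
  interpret real_distribution N by fact
  have "measure N {..<x} \<le> measure N {..x}"
    by (rule finite_measure_mono) auto
  then show ?thesis using assms(2) by (simp add: solves_cdf_eq_def cdf_def)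
qed

lemma solves_cdf_eq_iff:
  assumes "real_distribution N" and "isCont (cdf N) x"
  shows "solves_cdf_eq N p x \<longleftrightarrow> cdf N x = p"
proof -
  interpret real_distribution N by fact
  have "measure N {x} = 0" using assms(2) isCont_cdf by simp
  moreover have "measure N ({..<x} \<union> {x}) = measure N {..<x} + measure N {x}"
    by (rule finite_measure_Union) auto
  moreover have "{..<x} \<union> {x} = {..x}" by auto
  ultimately have "measure N {..<x} = cdf N x" by (simp add: cdf_def)
  then show ?thesis by (auto simp: solves_cdf_eq_def)
qed

end

theory Submission
  imports Defs
begin

text \<open>Measured in cumulative orders \<open>Y t\<close>, a planning problem with linear ordering costs falls apart
  into single periods. Summation by parts turns \<open>\<Sum> c t * x t\<close> into \<open>\<Sum> (c t - c (t + 1)) * Y t\<close>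
  plus a boundary term, and the expected inventory cost of period \<open>t\<close> depends on \<open>Y t\<close> only. So the
  objective is a sum of convex functions of one variable, each of them a newsvendor cost whose slope
  at \<open>y\<close> is \<open>(h t + b t) * (F y - p)\<close>, with \<open>p\<close> the critical ratio. The equation
  \<open>solves_cdf_eq\<close> says that zero is a subgradient of that function at \<open>y\<close>
  (\<open>newsvendor_cost_min_at_quantile\<close>, \<open>newsvendor_cost_argmin_solves\<close>). Nonnegative orders only
  require that \<open>Y\<close> be nondecreasing and start at or above zero.

  In the second stage, with inventory \<open>s\<close> and \<open>y = s + Y t\<close>, this means minimizing each
  newsvendor cost over \<open>y \<ge> s\<close>. By convexity \<open>max s (s + X t)\<close> is a minimizer, and since
  the levels are nondecreasing these minimizers are reached simultaneously by the order-up-to rule.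
  Conversely, an optimal plan must minimize every summand, and every minimizer over \<open>y \<ge> s\<close> has
  the form \<open>max s (s + X' t)\<close> for some solution \<open>X'\<close> of the level equation
  (\<open>argmin_above_eq_max_quantile\<close>).

  It follows that the value of the second stage is \<open>- c r * s\<close> plus a residual that never drops
  below the sum of the unconstrained minima and equals it as soon as all levels can be reached from
  \<open>s\<close>. The linear part supplies the coefficient \<open>c r\<close> that turns the ordering costs of the first
  stage into newsvendor costs. Replacing the residual by its minimum therefore bounds the
  first-stage cost from below by a separable function (\<open>first_stage_cost_ge\<close>). The order-up-to plan
  minimizes that function and, the second-stage levels being reachable almost surely, attains the
  bound. An optimal plan then has to minimize each newsvendor cost, so that its cumulative orders
  are themselves levels.\<close>

section \<open>The newsvendor cost of a single period\<close>

text \<open>The ordering rate \<open>a\<close> stands for \<open>c t - c (t + 1)\<close>, the extra cost of ordering a unit now rather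
  than one period later; \<open>y\<close> is the inventory position before the demand \<open>u\<close> is met.\<close>

definition newsvendor_cost :: "real measure \<Rightarrow> real \<Rightarrow> real \<Rightarrow> real \<Rightarrow> real \<Rightarrow> real" where
  "newsvendor_cost N a h b y = a * y + (\<integral>u. inventory_cost h b (y - u) \<partial>N)"

lemma inventory_cost_eq: "inventory_cost h b z = (h + b) * max z 0 - b * z"
  by (simp add: inventory_cost_def max_def min_def algebra_simps)

locale integrable_demand = real_distribution +
  assumes integrable_id: "integrable M (\<lambda>u. u)"
begin

lemma integrable_surplus: "integrable M (\<lambda>u. max (y - u) 0)"
  using integrable_id by (intro integrable_max) auto

lemma newsvendor_cost_eq:
  "newsvendor_cost M a h b y =
     (a - b) * y + b * expectation (\<lambda>u. u) + (h + b) * expectation (\<lambda>u. max (y - u) 0)"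
proof -
  have "expectation (\<lambda>u. inventory_cost h b (y - u)) =
      expectation (\<lambda>u. (h + b) * max (y - u) 0 - b * (y - u))"
    by (simp only: inventory_cost_eq)
  also have "\<dots> = (h + b) * expectation (\<lambda>u. max (y - u) 0) - b * (y - expectation (\<lambda>u. u))"
    using integrable_surplus[of y] integrable_id by (simp add: prob_space[simplified])
  finally show ?thesis
    by (simp add: newsvendor_cost_def algebra_simps)
qed

text \<open>The integrand grows by exactly \<open>z - y\<close> where \<open>u \<le> y\<close>, and by at most that on \<open>u < z\<close>, outside
  of which it does not grow. These one-sided bounds stand in for the derivative, which fails to exist
  at an atom of the demand; it is here that \<open>F(z-)\<close> enters beside \<open>F(y)\<close>.\<close>

lemma surplus_increment_bounds:
  assumes "y \<le> z"
  shows "(z - y) * cdf M y \<le> expectation (\<lambda>u. max (z - u) 0) - expectation (\<lambda>u. max (y - u) 0)"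
    and "expectation (\<lambda>u. max (z - u) 0) - expectation (\<lambda>u. max (y - u) 0) \<le> (z - y) * prob {..<z}"
proof -
  have ind: "integrable M (\<lambda>u. (z - y) * indicator A u)" if "A \<in> sets borel" for A
    using that by (intro integrable_mult_right integrable_real_indicator) (auto simp: emeasure_eq_measure)
  have inc: "expectation (\<lambda>u. max (z - u) 0 - max (y - u) 0) =
      expectation (\<lambda>u. max (z - u) 0) - expectation (\<lambda>u. max (y - u) 0)"
    using integrable_surplus by simp
  have "(z - y) * cdf M y = expectation (\<lambda>u. (z - y) * indicator {..y} u)"
    by (subst integral_mult_right_zero) (simp add: cdf_def)
  also have "\<dots> \<le> expectation (\<lambda>u. max (z - u) 0 - max (y - u) 0)"
    using assms
    by (intro integral_mono Bochner_Integration.integrable_diff integrable_surplus ind)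
      (auto simp: indicator_def max_def)
  finally show "(z - y) * cdf M y \<le>
      expectation (\<lambda>u. max (z - u) 0) - expectation (\<lambda>u. max (y - u) 0)"
    by (simp only: inc)
  have "expectation (\<lambda>u. max (z - u) 0 - max (y - u) 0) \<le>
      expectation (\<lambda>u. (z - y) * indicator {..<z} u)"
    using assms
    by (intro integral_mono Bochner_Integration.integrable_diff integrable_surplus ind)
      (auto simp: indicator_def max_def)
  also have "\<dots> = (z - y) * prob {..<z}"
    by simp
  finally show "expectation (\<lambda>u. max (z - u) 0) - expectation (\<lambda>u. max (y - u) 0) \<le>
      (z - y) * prob {..<z}"
    by (simp only: inc)
qed

lemma newsvendor_increment_bounds:
  assumes pos: "0 < h + b" and "y \<le> z"
  shows "(h + b) * (z - y) * (cdf M y - (b - a) / (h + b)) \<le>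
      newsvendor_cost M a h b z - newsvendor_cost M a h b y"
    and "newsvendor_cost M a h b z - newsvendor_cost M a h b y \<le>
      (h + b) * (z - y) * (prob {..<z} - (b - a) / (h + b))"
proof -
  have split: "(h + b) * (z - y) * (q - (b - a) / (h + b)) = (a - b) * (z - y) + (h + b) * ((z - y) * q)"
    for q using pos by (simp add: field_simps)
  show "(h + b) * (z - y) * (cdf M y - (b - a) / (h + b)) \<le>
      newsvendor_cost M a h b z - newsvendor_cost M a h b y"
    unfolding split newsvendor_cost_eq
    using mult_left_mono[OF surplus_increment_bounds(1)[OF \<open>y \<le> z\<close>], of "h + b"] pos
    by (simp add: algebra_simps)
  show "newsvendor_cost M a h b z - newsvendor_cost M a h b y \<le>
      (h + b) * (z - y) * (prob {..<z} - (b - a) / (h + b))"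
    unfolding split newsvendor_cost_eq
    using mult_left_mono[OF surplus_increment_bounds(2)[OF \<open>y \<le> z\<close>], of "h + b"] pos
    by (simp add: algebra_simps)
qed

text \<open>Beyond the quantile the lower slope bound is nonnegative and stays so, because distribution
  functions increase.\<close>

lemma newsvendor_cost_mono_right_of_quantile:
  assumes pos: "0 < h + b" and q: "(b - a) / (h + b) \<le> cdf M x" and "x \<le> y" "y \<le> z"
  shows "newsvendor_cost M a h b y \<le> newsvendor_cost M a h b z"
proof -
  have "(b - a) / (h + b) \<le> cdf M y"
    using q cdf_nondecreasing[OF \<open>x \<le> y\<close>] by linarith
  then have "0 \<le> (h + b) * (z - y) * (cdf M y - (b - a) / (h + b))"
    using pos \<open>y \<le> z\<close> by simp
  then show ?thesis
    using newsvendor_increment_bounds(1)[OF pos \<open>y \<le> z\<close>, of a] by linarith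
qed

lemma newsvendor_cost_min_at_quantile:
  assumes pos: "0 < h + b" and x: "solves_cdf_eq M ((b - a) / (h + b)) x"
  shows "newsvendor_cost M a h b x \<le> newsvendor_cost M a h b y"
proof (cases "x \<le> y")
  case True
  then show ?thesis
    using newsvendor_cost_mono_right_of_quantile[OF pos _ order_refl] x
    by (simp add: solves_cdf_eq_def)
next
  case False
  then have "(h + b) * (x - y) * (prob {..<x} - (b - a) / (h + b)) \<le> 0"
    using pos x by (intro mult_nonneg_nonpos) (auto simp: solves_cdf_eq_def)
  then show ?thesis
    using newsvendor_increment_bounds(2)[OF pos, of y x a] False by linarith
qed

lemma newsvendor_cost_min_above:
  assumes pos: "0 < h + b" and x: "solves_cdf_eq M ((b - a) / (h + b)) x" and "s \<le> y"
  shows "newsvendor_cost M a h b (max s x) \<le> newsvendor_cost M a h b y"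
proof (cases "s \<le> x")
  case True
  then show ?thesis
    using newsvendor_cost_min_at_quantile[OF pos x] by (simp add: max_def)
next
  case False
  then show ?thesis
    using newsvendor_cost_mono_right_of_quantile[OF pos, of a x s y] x \<open>s \<le> y\<close>
    by (simp add: max_def solves_cdf_eq_def)
qed

text \<open>For the converse the two halves of the level equation come from the two sides of the minimizer.
  They are separate lemmas because a minimizer over \<open>y \<ge> s\<close> that sits at \<open>s\<close> has a right side only.
  The bounds on the increments hold at neighbouring points, and passing to the limit gives \<open>F(y)\<close> from
  the right and \<open>F(y-)\<close> from the left.\<close>

lemma quantile_le_of_min_right:
  assumes pos: "0 < h + b"
    and min: "\<And>z. y < z \<Longrightarrow> newsvendor_cost M a h b y \<le> newsvendor_cost M a h b z"
  shows "(b - a) / (h + b) \<le> cdf M y"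
proof (rule tendsto_lowerbound)
  show "(cdf M \<longlongrightarrow> cdf M y) (at_right y)"
    using cdf_is_right_cont[of y] by (simp add: continuous_within)
  show "\<forall>\<^sub>F z in at_right y. (b - a) / (h + b) \<le> cdf M z"
    unfolding eventually_at_right_field
  proof (intro exI[of _ "y + 1"] conjI allI impI)
    fix z assume "y < z"
    then have "0 \<le> (h + b) * (z - y) * (prob {..<z} - (b - a) / (h + b))"
      using newsvendor_increment_bounds(2)[OF pos, of y z a] min[of z] by linarith
    moreover have "0 < (h + b) * (z - y)"
      using pos \<open>y < z\<close> by simp
    ultimately have "(b - a) / (h + b) \<le> prob {..<z}"
      by (simp add: zero_le_mult_iff del: zero_less_mult_iff)
    also have "\<dots> \<le> cdf M z"
      unfolding cdf_def by (rule finite_measure_mono) auto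
    finally show "(b - a) / (h + b) \<le> cdf M z" .
  qed simp
qed simp

lemma quantile_ge_of_min_left:
  assumes pos: "0 < h + b" and "l < y"
    and min: "\<And>w. l < w \<Longrightarrow> w < y \<Longrightarrow> newsvendor_cost M a h b y \<le> newsvendor_cost M a h b w"
  shows "prob {..<y} \<le> (b - a) / (h + b)"
proof (rule tendsto_upperbound)
  show "(cdf M \<longlongrightarrow> prob {..<y}) (at_left y)"
    by (rule cdf_at_left)
  show "\<forall>\<^sub>F w in at_left y. cdf M w \<le> (b - a) / (h + b)"
    unfolding eventually_at_left_field
  proof (intro exI[of _ l] conjI allI impI)
    fix w assume "l < w" "w < y"
    then have "(h + b) * (y - w) * (cdf M w - (b - a) / (h + b)) \<le> 0"
      using newsvendor_increment_bounds(1)[OF pos, of w y a] min[of w] by linarith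
    moreover have "0 < (h + b) * (y - w)"
      using pos \<open>w < y\<close> by simp
    ultimately show "cdf M w \<le> (b - a) / (h + b)"
      unfolding mult_le_0_iff[of "(h + b) * (y - w)"] by linarith
  qed (use \<open>l < y\<close> in simp)
qed simp

lemma newsvendor_cost_argmin_solves:
  assumes pos: "0 < h + b"
    and min: "\<And>z. newsvendor_cost M a h b y \<le> newsvendor_cost M a h b z"
  shows "solves_cdf_eq M ((b - a) / (h + b)) y"
  using quantile_le_of_min_right[OF pos min] quantile_ge_of_min_left[OF pos _ min, of "y - 1"]
  by (simp add: solves_cdf_eq_def)

text \<open>A minimizer in the interior \<open>y > s\<close> is itself a quantile. At the boundary \<open>y = s\<close> there are two
  cases. If \<open>x \<le> s\<close>, the given quantile \<open>x\<close> will do. If \<open>s < x\<close>, then \<open>F(y-) \<le> F(x-) \<le> p\<close>, the half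
  that the missing left side cannot supply, so \<open>y\<close> is again a quantile.\<close>

lemma argmin_above_eq_max_quantile:
  assumes pos: "0 < h + b"
    and x: "solves_cdf_eq M ((b - a) / (h + b)) x" and "s \<le> y"
    and eq: "newsvendor_cost M a h b y = newsvendor_cost M a h b (max s x)"
  shows "\<exists>x'. solves_cdf_eq M ((b - a) / (h + b)) x' \<and> y = max s x'"
proof -
  have min: "newsvendor_cost M a h b y \<le> newsvendor_cost M a h b z" if "s \<le> z" for z
    using newsvendor_cost_min_above[OF pos x that] eq by simp
  have right: "(b - a) / (h + b) \<le> cdf M y"
    by (rule quantile_le_of_min_right[OF pos min]) (use \<open>s \<le> y\<close> in simp)
  show ?thesis
  proof (cases "s < y \<or> y < x")
    case True
    have "prob {..<y} \<le> (b - a) / (h + b)"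
    proof (cases "s < y")
      case True
      show ?thesis by (rule quantile_ge_of_min_left[OF pos True min]) simp
    next
      case False
      then have "prob {..<y} \<le> prob {..<x}"
        using True by (intro finite_measure_mono) auto
      then show ?thesis using x by (simp add: solves_cdf_eq_def)
    qed
    with right have "solves_cdf_eq M ((b - a) / (h + b)) y"
      by (simp add: solves_cdf_eq_def)
    then show ?thesis using \<open>s \<le> y\<close> by (intro exI[of _ y]) simp
  next
    case False
    then show ?thesis using x \<open>s \<le> y\<close> by (intro exI[of _ x]) simp
  qed
qed

text \<open>This makes the value of the second stage a measurable and integrable function of the random
  inventory that it starts from.\<close>

lemma newsvendor_cost_lipschitz:
  "(\<bar>a - b\<bar> + \<bar>h + b\<bar>)-lipschitz_on UNIV (newsvendor_cost M a h b)"
proof (rule lipschitz_onI)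
  fix y z :: real
  have short: "\<bar>expectation (\<lambda>u. max (y - u) 0) - expectation (\<lambda>u. max (z - u) 0)\<bar> \<le> \<bar>y - z\<bar>"
    if "y \<le> z" for y z
  proof -
    have "(z - y) * prob {..<z} \<le> (z - y) * 1"
      using that by (intro mult_left_mono) auto
    with surplus_increment_bounds(2)[OF that]
    have "expectation (\<lambda>u. max (z - u) 0) - expectation (\<lambda>u. max (y - u) 0) \<le> z - y"
      by simp
    moreover have "0 \<le> (z - y) * cdf M y"
      using that by (simp add: cdf_def)
    with surplus_increment_bounds(1)[OF that]
    have "0 \<le> expectation (\<lambda>u. max (z - u) 0) - expectation (\<lambda>u. max (y - u) 0)"
      by simp
    ultimately show ?thesis
      using that by (simp add: abs_if)
  qed
  have "\<bar>expectation (\<lambda>u. max (y - u) 0) - expectation (\<lambda>u. max (z - u) 0)\<bar> \<le> \<bar>y - z\<bar>"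
    using short[of y z] short[of z y] by (cases "y \<le> z") (simp_all add: abs_minus_commute)
  then have "\<bar>h + b\<bar> * \<bar>expectation (\<lambda>u. max (y - u) 0) - expectation (\<lambda>u. max (z - u) 0)\<bar>
      \<le> \<bar>h + b\<bar> * \<bar>y - z\<bar>"
    by (intro mult_left_mono) auto
  moreover have "newsvendor_cost M a h b y - newsvendor_cost M a h b z =
      (a - b) * (y - z) + (h + b) *
        (expectation (\<lambda>u. max (y - u) 0) - expectation (\<lambda>u. max (z - u) 0))"
    by (simp add: newsvendor_cost_eq algebra_simps)
  then have "\<bar>newsvendor_cost M a h b y - newsvendor_cost M a h b z\<bar> \<le> \<bar>a - b\<bar> * \<bar>y - z\<bar> +
      \<bar>h + b\<bar> * \<bar>expectation (\<lambda>u. max (y - u) 0) - expectation (\<lambda>u. max (z - u) 0)\<bar>"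
    by (simp only: abs_mult[symmetric] abs_triangle_ineq)
  ultimately show "dist (newsvendor_cost M a h b y) (newsvendor_cost M a h b z) \<le>
      (\<bar>a - b\<bar> + \<bar>h + b\<bar>) * dist y z"
    unfolding dist_real_def distrib_right by linarith
qed simp

end

section \<open>Orders and cumulative order quantities\<close>

lemma sum_costs_by_cumulative_orders:
  fixes c x :: "nat \<Rightarrow> real"
  assumes "m \<le> Suc n"
  shows "(\<Sum>t=m..n. c t * x t) =
    (\<Sum>t=m..n. (c t - c (t + 1)) * (\<Sum>u=m..t. x u)) + c (n + 1) * (\<Sum>u=m..n. x u)"
  using assms
proof (induction n)
  case 0
  then show ?case by (cases "m = 0") (auto simp: algebra_simps)
next
  case (Suc n)
  then show ?case by (cases "m = Suc (Suc n)") (auto simp: algebra_simps)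
qed

lemma second_stage_orders_nonneg: "0 \<le> second_stage_orders r X t"
  by (subst second_stage_orders.simps) simp

lemma first_stage_orders_eq_second:
  assumes "0 \<le> X 1"
  shows "first_stage_orders X t = second_stage_orders 1 X t"
proof (induction t rule: less_induct)
  case (less t)
  then have "(\<Sum>u=1..<t. first_stage_orders X u) = (\<Sum>u=1..<t. second_stage_orders 1 X u)"
    by (intro sum.cong) auto
  then show ?case
    using assms by (subst first_stage_orders.simps, subst second_stage_orders.simps) simp
qed

text \<open>The cumulative order is the running maximum of zero and the levels so far, and for nondecreasing
  levels the last one dominates.\<close>

lemma cumulative_second_stage_orders:
  assumes "r \<le> t" and "\<And>u. r \<le> u \<Longrightarrow> u + 1 \<le> t \<Longrightarrow> X u \<le> X (u + 1)"
  shows "(\<Sum>u=r..t. second_stage_orders r X u) = max (X t) 0"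
  using assms
proof (induction t rule: dec_induct)
  case base
  then show ?case by (simp add: second_stage_orders.simps)
next
  case (step t)
  have "second_stage_orders r X (Suc t) =
      max (X (Suc t) - (\<Sum>u=r..t. second_stage_orders r X u)) 0"
    using step.hyps by (subst second_stage_orders.simps) (simp add: atLeastLessThanSuc_atLeastAtMost)
  moreover have "(\<Sum>u=r..t. second_stage_orders r X u) = max (X t) 0"
    using step.IH step.prems by simp
  moreover have "X t \<le> X (Suc t)"
    using step.prems[of t] step.hyps by simp
  ultimately show ?case
    using step.hyps by (auto simp: max_def)
qed

text \<open>The maximum with zero covers the periods before the first positive order: their levels are
  nonpositive but otherwise arbitrary, which is why a plan does not determine its levels.\<close>

lemma orders_determined_by_cumulative:
  assumes "nonneg_orders {r..T} x"
    and level: "\<And>t. t \<in> {r..T} \<Longrightarrow> (\<Sum>u=r..t. x u) = max (X t) 0"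
    and "t \<in> {r..T}"
  shows "x t = second_stage_orders r X t"
  using \<open>t \<in> {r..T}\<close>
proof (induction t rule: less_induct)
  case (less t)
  show ?case
  proof (cases "t = r")
    case True
    then show ?thesis
      using level[OF less.prems] by (simp add: second_stage_orders.simps)
  next
    case False
    then have t: "r < t" "t \<le> T" using less.prems by auto
    have prev: "(\<Sum>u=r..<t. second_stage_orders r X u) = (\<Sum>u=r..<t. x u)"
      using less.IH t by (intro sum.cong) auto
    have "{r..t} = insert t {r..<t}" using t by auto
    then have "(\<Sum>u=r..t. x u) = x t + (\<Sum>u=r..<t. x u)"
      by simp
    moreover have "0 \<le> (\<Sum>u=r..<t. x u)" "0 \<le> x t"
      using assms(1) t by (auto intro!: sum_nonneg simp: nonneg_orders_def)
    ultimately show ?thesis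
      using level[OF less.prems] t prev
      by (subst second_stage_orders.simps) (auto simp: max_def split: if_splits)
  qed
qed

section \<open>The demand between two periods\<close>

lemma net_inventory_eq: "net_inventory d x i j \<omega> = (\<Sum>t=i..j. x t) - demand_sum d i j \<omega>"
  by (simp add: net_inventory_def demand_sum_def sum_subtractf)

context prob_space
begin

lemma integrable_demand_sum:
  assumes "\<And>t. t \<in> {i..j} \<Longrightarrow> integrable M (d t)"
  shows "integrable M (demand_sum d i j)"
proof -
  have "integrable M (\<lambda>\<omega>. \<Sum>t=i..j. d t \<omega>)"
    by (rule Bochner_Integration.integrable_sum) (rule assms)
  then show ?thesis by (simp add: demand_sum_def[abs_def])
qed

lemma demand_law_integrable_demand:
  assumes "\<And>t. t \<in> {i..j} \<Longrightarrow> integrable M (d t)"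
  shows "integrable_demand (demand_law M d i j)"
proof -
  have "integrable M (demand_sum d i j)"
    using assms by (rule integrable_demand_sum)
  then have meas: "demand_sum d i j \<in> borel_measurable M" and
    int: "integrable (distr M borel (demand_sum d i j)) (\<lambda>u. u)"
    by (auto simp: integrable_distr_eq)
  then show ?thesis
    unfolding demand_law_def
    by (intro integrable_demand.intro integrable_demand_axioms.intro real_distribution_distr)
qed

text \<open>The joint law of the demands enters the cost only through the laws of their partial sums.\<close>

lemma expected_inventory_cost:
  assumes "\<And>t. t \<in> {i..j} \<Longrightarrow> integrable M (d t)"
  shows "a * y + (\<integral>\<omega>. inventory_cost h b (y - demand_sum d i j \<omega>) \<partial>M) =
    newsvendor_cost (demand_law M d i j) a h b y"
proof -
  have "demand_sum d i j \<in> borel_measurable M"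
    by (rule borel_measurable_integrable[OF integrable_demand_sum]) (rule assms)
  then show ?thesis
    unfolding newsvendor_cost_def demand_law_def
    by (subst integral_distr) (auto simp: inventory_cost_def)
qed

lemma integrable_lipschitz_compose:
  fixes f :: "real \<Rightarrow> real"
  assumes "L-lipschitz_on UNIV f" and int: "integrable M g"
  shows "integrable M (\<lambda>\<omega>. f (g \<omega>))"
proof (rule Bochner_Integration.integrable_bound)
  show "integrable M (\<lambda>\<omega>. \<bar>f 0\<bar> + L * \<bar>g \<omega>\<bar>)"
    using int by simp
  have "f \<in> borel_measurable borel"
    by (rule borel_measurable_continuous_onI[OF lipschitz_on_continuous_on[OF assms(1)]])
  then show "(\<lambda>\<omega>. f (g \<omega>)) \<in> borel_measurable M"
    using int by measurable
  have "\<bar>f y - f 0\<bar> \<le> L * \<bar>y\<bar>" for y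
    using lipschitz_onD[OF assms(1), of y 0] by (simp add: dist_real_def)
  then have "\<bar>f y\<bar> \<le> \<bar>\<bar>f 0\<bar> + L * \<bar>y\<bar>\<bar>" for y
    using abs_triangle_ineq4[of "f y" "f 0"] abs_triangle_ineq2[of "f y" "f 0"]
    by (intro order_trans[OF _ abs_ge_self]) (metis add.commute diff_le_eq order_trans)
  then show "AE \<omega> in M. norm (f (g \<omega>)) \<le> norm (\<bar>f 0\<bar> + L * \<bar>g \<omega>\<bar>)"
    by simp
qed

end

section \<open>The cost of a planning stage\<close>

lemma critical_ratio_eq: "critical_ratio c h b t = (b t - (c t - c (t + 1))) / (h t + b t)"
  by (simp add: critical_ratio_def algebra_simps)

lemma sum_cost_differences:
  fixes c :: "nat \<Rightarrow> real"
  assumes "m \<le> Suc n"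
  shows "(\<Sum>t=m..n. c t - c (t + 1)) = c m - c (n + 1)"
  using sum_Suc_diff[OF assms, of "\<lambda>t. - c t"] by simp

text \<open>Both stages are instances of this locale: the first covers the periods \<open>1\<close> to \<open>r - 1\<close>, the second
  \<open>r\<close> to \<open>T\<close>. The bound \<open>m \<le> Suc n\<close> admits a stage without periods, which the first one is when the
  revision takes place at once.\<close>

locale inventory_stage = prob_space M for M :: "'a measure" +
  fixes m n :: nat and c h b :: "nat \<Rightarrow> real" and d :: "nat \<Rightarrow> 'a \<Rightarrow> real"
  assumes stage_bounds: "m \<le> Suc n"
    and integrable_demand: "\<And>t. t \<in> {m..n} \<Longrightarrow> integrable M (d t)"
    and cost_rates_pos: "\<And>t. t \<in> {m..n} \<Longrightarrow> 0 < h t + b t"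
begin

definition level_cost :: "nat \<Rightarrow> real \<Rightarrow> real" where
  "level_cost t = newsvendor_cost (demand_law M d m t) (c t - c (t + 1)) (h t) (b t)"

definition solves_level :: "nat \<Rightarrow> real \<Rightarrow> bool" where
  "solves_level t y \<longleftrightarrow> solves_cdf_eq (demand_law M d m t) (critical_ratio c h b t) y"

lemma integrable_demand_law:
  assumes "t \<in> {m..n}"
  shows "integrable_demand (demand_law M d m t)"
  using assms by (intro demand_law_integrable_demand integrable_demand) auto

lemma level_cost_lipschitz:
  assumes "t \<in> {m..n}"
  shows "\<exists>L. L-lipschitz_on UNIV (level_cost t)"
  unfolding level_cost_def
  using integrable_demand.newsvendor_cost_lipschitz[OF integrable_demand_law[OF assms]] by blast

lemma level_cost_min:
  assumes t: "t \<in> {m..n}" and "solves_level t y"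
  shows "level_cost t y \<le> level_cost t z"
  using assms(2-) unfolding level_cost_def solves_level_def critical_ratio_eq
  by (rule integrable_demand.newsvendor_cost_min_at_quantile[OF integrable_demand_law[OF t] cost_rates_pos[OF t]])

lemma level_cost_argmin_solves:
  assumes t: "t \<in> {m..n}" and "\<And>z. level_cost t y \<le> level_cost t z"
  shows "solves_level t y"
  using assms(2-) unfolding level_cost_def solves_level_def critical_ratio_eq
  by (rule integrable_demand.newsvendor_cost_argmin_solves[OF integrable_demand_law[OF t] cost_rates_pos[OF t]])

lemma level_cost_min_above:
  assumes t: "t \<in> {m..n}" and "solves_level t y" "s \<le> z"
  shows "level_cost t (max s y) \<le> level_cost t z"
  using assms(2-) unfolding level_cost_def solves_level_def critical_ratio_eq
  by (rule integrable_demand.newsvendor_cost_min_above[OF integrable_demand_law[OF t] cost_rates_pos[OF t]])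

lemma level_cost_argmin_above:
  assumes t: "t \<in> {m..n}" and "solves_level t y" "s \<le> z" "level_cost t z = level_cost t (max s y)"
  shows "\<exists>y'. solves_level t y' \<and> z = max s y'"
  using assms(2-) unfolding level_cost_def solves_level_def critical_ratio_eq
  by (rule integrable_demand.argmin_above_eq_max_quantile[OF integrable_demand_law[OF t] cost_rates_pos[OF t]])

text \<open>Summation by parts leaves two boundary terms. The one at the end charges the cumulative order of
  the stage at the rate of the next period: it vanishes for the last stage, and in the first stage it
  cancels against the linear part of the second-stage value. The one in \<open>s\<close> appears because the
  newsvendor costs charge the initial inventory as if it had been ordered.\<close>

lemma stage_cost_eq:
  "(\<Sum>t=m..n. c t * x t + (\<integral>\<omega>. inventory_cost (h t) (b t) (s + net_inventory d x m t \<omega>) \<partial>M)) =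
   (\<Sum>t=m..n. level_cost t (s + (\<Sum>u=m..t. x u))) - (c m - c (n + 1)) * s + c (n + 1) * (\<Sum>u=m..n. x u)"
proof -
  define Y where "Y t = (\<Sum>u=m..t. x u)" for t
  define I where "I t = (\<integral>\<omega>. inventory_cost (h t) (b t) (s + net_inventory d x m t \<omega>) \<partial>M)" for t
  have I: "(c t - c (t + 1)) * (s + Y t) + I t = level_cost t (s + Y t)" if "t \<in> {m..n}" for t
  proof -
    have "I t = (\<integral>\<omega>. inventory_cost (h t) (b t) (s + Y t - demand_sum d m t \<omega>) \<partial>M)"
      by (simp add: I_def Y_def net_inventory_eq algebra_simps)
    then show ?thesis
      unfolding level_cost_def
      using that by (simp only:) (rule expected_inventory_cost, rule integrable_demand, simp)
  qed
  have "(\<Sum>t=m..n. level_cost t (s + Y t)) =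
      (\<Sum>t=m..n. (c t - c (t + 1)) * s + ((c t - c (t + 1)) * Y t + I t))"
    by (intro sum.cong refl) (simp add: I[symmetric] algebra_simps)
  also have "\<dots> = (c m - c (n + 1)) * s + ((\<Sum>t=m..n. (c t - c (t + 1)) * Y t) + (\<Sum>t=m..n. I t))"
    by (simp only: sum.distrib sum_distrib_right[symmetric] sum_cost_differences[OF stage_bounds])
  finally show ?thesis
    using sum_costs_by_cumulative_orders[OF stage_bounds, of c x]
    by (simp add: sum.distrib I_def[symmetric] Y_def[symmetric])
qed

end

locale final_stage = inventory_stage +
  assumes no_later_cost: "c (n + 1) = 0"
begin

lemma second_stage_cost_eq:
  "second_stage_cost M n m c h b d s x = (\<Sum>t=m..n. level_cost t (s + (\<Sum>u=m..t. x u))) - c m * s"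
  unfolding second_stage_cost_def by (simp only: stage_cost_eq no_later_cost) simp

lemma second_stage_cost_ge:
  assumes "nonneg_orders {m..n} x" and X: "\<And>t. t \<in> {m..n} \<Longrightarrow> solves_level t (s + X t)"
  shows "(\<Sum>t=m..n. level_cost t (max s (s + X t))) - c m * s \<le> second_stage_cost M n m c h b d s x"
proof -
  have "0 \<le> (\<Sum>u=m..t. x u)" if "t \<in> {m..n}" for t
    using assms(1) that by (intro sum_nonneg) (auto simp: nonneg_orders_def)
  then have "(\<Sum>t=m..n. level_cost t (max s (s + X t))) \<le> (\<Sum>t=m..n. level_cost t (s + (\<Sum>u=m..t. x u)))"
    by (intro sum_mono level_cost_min_above X) auto
  then show ?thesis by (simp add: second_stage_cost_eq)
qed

lemma second_stage_cost_order_up_to: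
  assumes mono: "\<And>t. m \<le> t \<Longrightarrow> t + 1 \<le> n \<Longrightarrow> X t \<le> X (t + 1)"
  shows "second_stage_cost M n m c h b d s (second_stage_orders m X) =
    (\<Sum>t=m..n. level_cost t (max s (s + X t))) - c m * s"
proof -
  have "s + (\<Sum>u=m..t. second_stage_orders m X u) = max s (s + X t)" if "t \<in> {m..n}" for t
    using that mono by (subst cumulative_second_stage_orders) auto
  then show ?thesis by (simp add: second_stage_cost_eq)
qed

lemma second_stage_orders_optimal:
  assumes X: "\<And>t. t \<in> {m..n} \<Longrightarrow> solves_level t (s + X t)"
    and mono: "\<And>t. m \<le> t \<Longrightarrow> t + 1 \<le> n \<Longrightarrow> X t \<le> X (t + 1)"
  shows "is_arg_min (second_stage_cost M n m c h b d s) (nonneg_orders {m..n}) (second_stage_orders m X)"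
  unfolding is_arg_min_linorder
proof (intro conjI allI impI)
  fix x assume "nonneg_orders {m..n} x"
  then have "(\<Sum>t=m..n. level_cost t (max s (s + X t))) - c m * s \<le> second_stage_cost M n m c h b d s x"
    using X by (rule second_stage_cost_ge)
  also have "(\<Sum>t=m..n. level_cost t (max s (s + X t))) - c m * s =
      second_stage_cost M n m c h b d s (second_stage_orders m X)"
    using mono by (rule second_stage_cost_order_up_to[symmetric])
  finally show "second_stage_cost M n m c h b d s (second_stage_orders m X) \<le>
      second_stage_cost M n m c h b d s x" .
qed (simp add: nonneg_orders_def second_stage_orders_nonneg)

lemma second_stage_value_eq:
  assumes X: "\<And>t. t \<in> {m..n} \<Longrightarrow> solves_level t (s + X t)"
    and mono: "\<And>t. m \<le> t \<Longrightarrow> t + 1 \<le> n \<Longrightarrow> X t \<le> X (t + 1)"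
  shows "second_stage_value M n m c h b d s = (\<Sum>t=m..n. level_cost t (max s (s + X t))) - c m * s"
proof -
  have opt: "is_arg_min (second_stage_cost M n m c h b d s) (nonneg_orders {m..n}) (second_stage_orders m X)"
    using X mono by (rule second_stage_orders_optimal)
  have "second_stage_value M n m c h b d s = second_stage_cost M n m c h b d s (second_stage_orders m X)"
    unfolding second_stage_value_def
    by (rule cInf_eq_minimum) (use opt in \<open>auto simp: is_arg_min_linorder\<close>)
  also have "\<dots> = (\<Sum>t=m..n. level_cost t (max s (s + X t))) - c m * s"
    using mono by (rule second_stage_cost_order_up_to)
  finally show ?thesis .
qed

text \<open>The order-up-to plan minimizes all summands at once, so a plan with the same total must do so as
  well.\<close>

lemma second_stage_optimal_is_order_up_to:
  assumes X: "\<And>t. t \<in> {m..n} \<Longrightarrow> solves_level t (s + X t)"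
    and mono: "\<And>t. m \<le> t \<Longrightarrow> t + 1 \<le> n \<Longrightarrow> X t \<le> X (t + 1)"
    and opt: "is_arg_min (second_stage_cost M n m c h b d s) (nonneg_orders {m..n}) x"
  shows "\<exists>X'. (\<forall>t\<in>{m..n}. solves_level t (s + X' t)) \<and> (\<forall>t\<in>{m..n}. x t = second_stage_orders m X' t)"
proof -
  define Y where "Y t = (\<Sum>u=m..t. x u)" for t
  have x: "nonneg_orders {m..n} x"
    using opt by (simp add: is_arg_min_def)
  have Y: "0 \<le> Y t" if "t \<in> {m..n}" for t
    unfolding Y_def using x that by (intro sum_nonneg) (auto simp: nonneg_orders_def)
  have le: "level_cost t (max s (s + X t)) \<le> level_cost t (s + Y t)" if "t \<in> {m..n}" for t
    using Y[OF that] by (intro level_cost_min_above that X) simp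
  have "second_stage_cost M n m c h b d s x \<le> second_stage_cost M n m c h b d s (second_stage_orders m X)"
    using opt by (auto simp: is_arg_min_linorder nonneg_orders_def second_stage_orders_nonneg)
  also have "\<dots> = (\<Sum>t=m..n. level_cost t (max s (s + X t))) - c m * s"
    using mono by (rule second_stage_cost_order_up_to)
  finally have "(\<Sum>t=m..n. level_cost t (s + Y t)) \<le> (\<Sum>t=m..n. level_cost t (max s (s + X t)))"
    by (simp add: second_stage_cost_eq Y_def)
  then have "(\<Sum>t=m..n. level_cost t (max s (s + X t))) = (\<Sum>t=m..n. level_cost t (s + Y t))"
    using sum_mono[OF le] by (rule antisym[rotated])
  then have "level_cost t (max s (s + X t)) = level_cost t (s + Y t)" if "t \<in> {m..n}" for t
    by (rule sum_mono_inv[OF _ le that]) simp_all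
  then have "\<exists>y. solves_level t y \<and> s + Y t = max s y" if "t \<in> {m..n}" for t
    using that Y[OF that] by (intro level_cost_argmin_above[OF that X[OF that]]) auto
  then obtain y where y: "\<And>t. t \<in> {m..n} \<Longrightarrow> solves_level t (y t) \<and> s + Y t = max s (y t)"
    by metis
  \<comment> \<open>\<open>y\<close> holds absolute levels, the order-up-to rule wants them relative to \<open>s\<close>\<close>
  have "x t = second_stage_orders m (\<lambda>t. y t - s) t" if "t \<in> {m..n}" for t
  proof (rule orders_determined_by_cumulative[OF x _ that])
    fix t assume "t \<in> {m..n}"
    then show "(\<Sum>u=m..t. x u) = max (y t - s) 0"
      using y[of t] by (simp add: Y_def max_def split: if_splits)
  qed
  then show ?thesis
    using y by (intro exI[of _ "\<lambda>t. y t - s"]) auto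
qed

end

section \<open>The first stage\<close>

lemma first_le_of_steps:
  fixes f :: "nat \<Rightarrow> real"
  assumes "m \<le> t" and "\<And>u. m \<le> u \<Longrightarrow> u + 1 \<le> t \<Longrightarrow> f u \<le> f (u + 1)"
  shows "f m \<le> f t"
  using assms
proof (induction t rule: dec_induct)
  case (step t)
  have "f m \<le> f t" using step.IH step.prems by simp
  also have "\<dots> \<le> f (Suc t)" using step.prems[of t] step.hyps by simp
  finally show ?case .
qed simp

text \<open>The family \<open>X2\<close> supplies, for every inventory \<open>s\<close>, second-stage levels relative to \<open>s\<close>; the
  absolute levels \<open>s + X2 s t\<close> solve an equation in which \<open>s\<close> does not occur, so \<open>X2 0\<close> serves as a
  common choice for all \<open>s\<close>.\<close>

locale two_stage_planning = prob_space M for M :: "'a measure" +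
  fixes T r :: nat and c h b :: "nat \<Rightarrow> real" and d :: "nat \<Rightarrow> 'a \<Rightarrow> real"
    and X2 :: "real \<Rightarrow> nat \<Rightarrow> real"
  assumes r: "1 \<le> r" "r \<le> T"
    and demand: "\<And>t. t \<in> {1..T} \<Longrightarrow> integrable M (d t)"
    and c_end: "c (T + 1) = 0"
    and denom: "\<And>t. t \<in> {1..T} \<Longrightarrow> 0 < h t + b t"
    and X2: "\<And>s t. t \<in> {r..T} \<Longrightarrow>
               solves_cdf_eq (demand_law M d r t) (critical_ratio c h b t) (s + X2 s t)"
    and X2_mono: "\<And>s t. r \<le> t \<Longrightarrow> t + 1 \<le> T \<Longrightarrow> X2 s t \<le> X2 s (t + 1)"
begin

sublocale first: inventory_stage M 1 "r - 1" c h b d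
  using r by unfold_locales (auto intro!: demand denom)

sublocale second: final_stage M r T c h b d
  using r by unfold_locales (auto intro!: demand denom c_end[simplified])

lemma X2_solves: "t \<in> {r..T} \<Longrightarrow> second.solves_level t (s + X2 s t)"
  by (simp add: second.solves_level_def X2)

text \<open>What remains of the second-stage value once the credit \<open>c r * s\<close> for the inventory is taken out.
  Using the fixed levels \<open>X2 0\<close> makes it a sum of Lipschitz functions of \<open>s\<close>, although \<open>X2 s\<close> may
  depend on \<open>s\<close> in a nonmeasurable way.\<close>

definition residual_cost :: "real \<Rightarrow> real" where
  "residual_cost s = (\<Sum>t=r..T. second.level_cost t (max s (X2 0 t)))"

definition least_residual_cost :: real where
  "least_residual_cost = (\<Sum>t=r..T. second.level_cost t (X2 0 t))"

lemma second_stage_value_eq_residual: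
  "second_stage_value M T r c h b d s = residual_cost s - c r * s"
  unfolding residual_cost_def
  using second.second_stage_value_eq[of s "\<lambda>t. X2 0 t - s"] X2_solves[of _ 0] X2_mono[of _ 0]
  by simp

lemma level_cost_X2_0: "t \<in> {r..T} \<Longrightarrow> second.level_cost t (s + X2 s t) = second.level_cost t (X2 0 t)"
  using second.level_cost_min[OF _ X2_solves] second.level_cost_min[OF _ X2_solves[of t 0]]
  by (intro antisym) auto

lemma least_residual_cost_le: "least_residual_cost \<le> residual_cost s"
  unfolding residual_cost_def least_residual_cost_def
  using X2_solves[of _ 0] by (intro sum_mono second.level_cost_min) auto

text \<open>The value does not depend on the chosen solution of the level equation, so it may be computed from
  \<open>X2 s\<close>, whose levels all lie above the inventory once the first one does.\<close>

lemma residual_cost_eq_least: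
  assumes "0 \<le> X2 s r"
  shows "residual_cost s = least_residual_cost"
proof -
  have "residual_cost s = (\<Sum>t=r..T. second.level_cost t (max s (s + X2 s t)))"
    using second.second_stage_value_eq[of s "X2 s", OF X2_solves X2_mono]
    by (simp add: second_stage_value_eq_residual)
  also have "\<dots> = (\<Sum>t=r..T. second.level_cost t (X2 0 t))"
  proof (intro sum.cong refl)
    fix t assume t: "t \<in> {r..T}"
    then have "X2 s r \<le> X2 s t"
      by (intro first_le_of_steps[of r t "X2 s"] X2_mono) auto
    with assms have "max s (s + X2 s t) = s + X2 s t" by simp
    then show "second.level_cost t (max s (s + X2 s t)) = second.level_cost t (X2 0 t)"
      by (simp only: level_cost_X2_0[OF t])
  qed
  finally show ?thesis by (simp add: least_residual_cost_def)
qed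

lemma integrable_first_stage_demand: "integrable M (demand_sum d 1 (r - 1))"
  by (rule integrable_demand_sum) (use first.integrable_demand in auto)

lemma integrable_residual_cost:
  "integrable M (\<lambda>\<omega>. residual_cost (net_inventory d x 1 (r - 1) \<omega>))"
  unfolding residual_cost_def
proof (rule Bochner_Integration.integrable_sum)
  fix t assume "t \<in> {r..T}"
  then obtain L where "L-lipschitz_on UNIV (second.level_cost t)"
    using second.level_cost_lipschitz by blast
  moreover have "integrable M (\<lambda>\<omega>. max (net_inventory d x 1 (r - 1) \<omega>) (X2 0 t))"
    unfolding net_inventory_eq using integrable_first_stage_demand by (intro integrable_max) auto
  ultimately show "integrable M (\<lambda>\<omega>. second.level_cost t (max (net_inventory d x 1 (r - 1) \<omega>) (X2 0 t)))"
    by (rule integrable_lipschitz_compose)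
qed

lemma first_stage_cost_eq:
  "first_stage_cost M T r c h b d x =
     (\<Sum>t=1..r-1. first.level_cost t (\<Sum>u=1..t. x u)) + c r * expectation (demand_sum d 1 (r - 1)) +
     expectation (\<lambda>\<omega>. residual_cost (net_inventory d x 1 (r - 1) \<omega>))"
proof -
  have "expectation (\<lambda>\<omega>. second_stage_value M T r c h b d (net_inventory d x 1 (r - 1) \<omega>)) =
      expectation (\<lambda>\<omega>. residual_cost (net_inventory d x 1 (r - 1) \<omega>)) -
      expectation (\<lambda>\<omega>. c r * ((\<Sum>u=1..r-1. x u) - demand_sum d 1 (r - 1) \<omega>))"
    unfolding second_stage_value_eq_residual
    using integrable_residual_cost[of x] integrable_first_stage_demand
    by (subst Bochner_Integration.integral_diff) (auto simp: net_inventory_eq)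
  also have "expectation (\<lambda>\<omega>. c r * ((\<Sum>u=1..r-1. x u) - demand_sum d 1 (r - 1) \<omega>)) =
      c r * ((\<Sum>u=1..r-1. x u) - expectation (demand_sum d 1 (r - 1)))"
    using integrable_first_stage_demand by (simp add: prob_space)
  finally show ?thesis
    using first.stage_cost_eq[of x 0] r by (simp add: first_stage_cost_def algebra_simps)
qed

text \<open>The bound separates into functions of the single cumulative orders, which the first-stage cost
  itself does not because of the residual.\<close>

lemma first_stage_cost_ge:
  "(\<Sum>t=1..r-1. first.level_cost t (\<Sum>u=1..t. x u)) + c r * expectation (demand_sum d 1 (r - 1)) +
     least_residual_cost \<le> first_stage_cost M T r c h b d x"
proof -
  have "least_residual_cost = expectation (\<lambda>\<omega>. least_residual_cost)"
    by (simp add: prob_space)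
  also have "\<dots> \<le> expectation (\<lambda>\<omega>. residual_cost (net_inventory d x 1 (r - 1) \<omega>))"
    by (intro integral_mono integrable_residual_cost least_residual_cost_le) simp
  finally show ?thesis by (simp add: first_stage_cost_eq)
qed

context
  fixes X1 :: "nat \<Rightarrow> real"
  assumes two_stages: "1 < r"
    and X1: "\<And>t. t \<in> {1..r-1} \<Longrightarrow>
               solves_cdf_eq (demand_law M d 1 t) (critical_ratio c h b t) (X1 t)"
    and X1_nonneg: "0 \<le> X1 1"
    and X1_mono: "\<And>t. 1 \<le> t \<Longrightarrow> t + 1 \<le> r - 1 \<Longrightarrow> X1 t \<le> X1 (t + 1)"
    and X2_nonneg: "AE \<omega> in M. 0 \<le> X2 (net_inventory d (first_stage_orders X1) 1 (r - 1) \<omega>) r"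
begin

lemma X1_min: "t \<in> {1..r-1} \<Longrightarrow> first.level_cost t (X1 t) \<le> first.level_cost t y"
  by (rule first.level_cost_min) (simp_all only: first.solves_level_def X1)

lemma cumulative_first_stage_orders:
  assumes "t \<in> {1..r-1}"
  shows "(\<Sum>u=1..t. first_stage_orders X1 u) = X1 t"
proof -
  have "X1 1 \<le> X1 t"
    using assms by (intro first_le_of_steps[of 1 t X1] X1_mono) auto
  moreover have "(\<Sum>u=1..t. second_stage_orders 1 X1 u) = max (X1 t) 0"
    using assms X1_mono by (intro cumulative_second_stage_orders) auto
  ultimately show ?thesis
    using X1_nonneg by (simp add: first_stage_orders_eq_second[of X1, OF X1_nonneg])
qed

text \<open>Since the second stage can reach its levels almost surely, the lower bound is attained.\<close>

lemma first_stage_cost_order_up_to: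
  "first_stage_cost M T r c h b d (first_stage_orders X1) =
     (\<Sum>t=1..r-1. first.level_cost t (X1 t)) + c r * expectation (demand_sum d 1 (r - 1)) +
     least_residual_cost"
proof -
  have "expectation (\<lambda>\<omega>. residual_cost (net_inventory d (first_stage_orders X1) 1 (r - 1) \<omega>)) =
      expectation (\<lambda>\<omega>. least_residual_cost)"
    using X2_nonneg residual_cost_eq_least
      borel_measurable_integrable[OF integrable_residual_cost[of "first_stage_orders X1"]]
    by (intro integral_cong_AE) auto
  also have "\<dots> = least_residual_cost"
    by (simp add: prob_space)
  finally show ?thesis
    unfolding first_stage_cost_eq by (simp only: cumulative_first_stage_orders cong: sum.cong)
qed

lemma nonneg_first_stage_orders: "nonneg_orders A (first_stage_orders X1)"
  by (simp add: nonneg_orders_def first_stage_orders_eq_second[of X1, OF X1_nonneg] second_stage_orders_nonneg)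

lemma first_stage_orders_optimal:
  "is_arg_min (first_stage_cost M T r c h b d) (nonneg_orders {1..r-1}) (first_stage_orders X1)"
  unfolding is_arg_min_linorder
proof (intro conjI allI impI nonneg_first_stage_orders)
  fix x
  have "(\<Sum>t=1..r-1. first.level_cost t (X1 t)) \<le> (\<Sum>t=1..r-1. first.level_cost t (\<Sum>u=1..t. x u))"
    by (intro sum_mono X1_min)
  then show "first_stage_cost M T r c h b d (first_stage_orders X1) \<le> first_stage_cost M T r c h b d x"
    using first_stage_cost_ge[of x] by (simp add: first_stage_cost_order_up_to)
qed

text \<open>Each \<open>X1 t\<close> is an unconstrained minimizer, hence so are the cumulative orders of an optimal plan,
  and these are the levels sought.\<close>

lemma first_stage_optimal_is_order_up_to:
  assumes opt: "is_arg_min (first_stage_cost M T r c h b d) (nonneg_orders {1..r-1}) x"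
  shows "\<exists>X. (\<forall>t\<in>{1..r-1}. solves_cdf_eq (demand_law M d 1 t) (critical_ratio c h b t) (X t)) \<and>
           (\<forall>t\<in>{1..r-1}. x t = first_stage_orders X t)"
proof -
  define Y where "Y t = (\<Sum>u=1..t. x u)" for t
  have x: "nonneg_orders {1..r-1} x"
    using opt by (simp add: is_arg_min_def)
  have Y: "0 \<le> Y t" if "t \<in> {1..r-1}" for t
    unfolding Y_def using x that by (intro sum_nonneg) (auto simp: nonneg_orders_def)
  have "first_stage_cost M T r c h b d x \<le> first_stage_cost M T r c h b d (first_stage_orders X1)"
    using opt nonneg_first_stage_orders by (auto simp: is_arg_min_linorder)
  then have "(\<Sum>t=1..r-1. first.level_cost t (Y t)) \<le> (\<Sum>t=1..r-1. first.level_cost t (X1 t))"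
    using first_stage_cost_ge[of x] by (simp add: first_stage_cost_order_up_to Y_def)
  then have "(\<Sum>t=1..r-1. first.level_cost t (X1 t)) = (\<Sum>t=1..r-1. first.level_cost t (Y t))"
    using sum_mono[OF X1_min] by (rule antisym[rotated])
  then have eq: "first.level_cost t (X1 t) = first.level_cost t (Y t)" if "t \<in> {1..r-1}" for t
    by (rule sum_mono_inv[OF _ X1_min that]) simp_all
  have solves: "first.solves_level t (Y t)" if "t \<in> {1..r-1}" for t
    using that X1_min[OF that] unfolding eq[OF that] by (rule first.level_cost_argmin_solves)
  have "0 \<le> Y 1" using Y[of 1] two_stages by simp
  moreover have "x t = second_stage_orders 1 Y t" if "t \<in> {1..r-1}" for t
    using Y by (intro orders_determined_by_cumulative[OF x _ that]) (auto simp: Y_def)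
  ultimately have "x t = first_stage_orders Y t" if "t \<in> {1..r-1}" for t
    using that first_stage_orders_eq_second by simp
  then show ?thesis
    using solves unfolding first.solves_level_def by blast
qed

end

end

text \<open>With the revision in the first period nothing is decided before it, and every plan is optimal.\<close>

lemma single_stage_first_cost:
  "first_stage_cost M T 1 c h b d x = first_stage_cost M T 1 c h b d y"
  by (simp add: first_stage_cost_def net_inventory_def)

theorem theorem1:
  fixes M :: "'a measure" and T r :: nat
    and c h b :: "nat \<Rightarrow> real"
    and d :: "nat \<Rightarrow> 'a \<Rightarrow> real" and d1 :: real
    and X1 :: "nat \<Rightarrow> real" and X2 :: "real \<Rightarrow> nat \<Rightarrow> real"
  assumes "prob_space M"
    and r: "1 \<le> r" "r \<le> T"
    and demand: "\<And>t. t \<in> {1..T} \<Longrightarrow> integrable M (d t)"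
    and d1: "\<And>\<omega>. \<omega> \<in> space M \<Longrightarrow> d 1 \<omega> = d1"
    and cost: "\<And>t. t \<in> {1..<T} \<Longrightarrow> c t - b t \<le> c (t + 1) \<and> c (t + 1) \<le> c t + h t"
    and cost_T: "c T \<le> b T"
    and c_end: "c (T + 1) = 0"
    and denom: "\<And>t. t \<in> {1..T} \<Longrightarrow> 0 < h t + b t"
    \<comment> \<open>order-up-to levels; those of the second stage depend on the observed inventory \<open>s\<close>\<close>
    and X1: "\<And>t. t \<in> {1..r-1} \<Longrightarrow>
               solves_cdf_eq (demand_law M d 1 t) (critical_ratio c h b t) (X1 t)"
    and X2: "\<And>s t. t \<in> {r..T} \<Longrightarrow>
               solves_cdf_eq (demand_law M d r t) (critical_ratio c h b t) (s + X2 s t)"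
    \<comment> \<open>the levels can be reached one after the other with nonnegative orders\<close>
    and X1_nonneg: "1 < r \<Longrightarrow> 0 \<le> X1 1"
    and X1_mono: "\<And>t. 1 \<le> t \<Longrightarrow> t + 1 \<le> r - 1 \<Longrightarrow> X1 t \<le> X1 (t + 1)"
    and X2_mono: "\<And>s t. r \<le> t \<Longrightarrow> t + 1 \<le> T \<Longrightarrow> X2 s t \<le> X2 s (t + 1)"
    and X2_nonneg: "1 < r \<Longrightarrow>
               AE \<omega> in M. 0 \<le> X2 (net_inventory d (first_stage_orders X1) 1 (r - 1) \<omega>) r"
  shows
    \<comment> \<open>the orders given by the levels are optimal in both stages\<close>
    "is_arg_min (first_stage_cost M T r c h b d) (nonneg_orders {1..r-1}) (first_stage_orders X1) \<and>
     (\<forall>s. is_arg_min (second_stage_cost M T r c h b d s) (nonneg_orders {r..T})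
            (second_stage_orders r (X2 s))) \<and>
     \<comment> \<open>all optimal orders are given by such levels\<close>
     (\<forall>x. is_arg_min (first_stage_cost M T r c h b d) (nonneg_orders {1..r-1}) x \<longrightarrow>
        (\<exists>X. (\<forall>t\<in>{1..r-1}. solves_cdf_eq (demand_law M d 1 t) (critical_ratio c h b t) (X t)) \<and>
             (\<forall>t\<in>{1..r-1}. x t = first_stage_orders X t))) \<and>
     (\<forall>s x. is_arg_min (second_stage_cost M T r c h b d s) (nonneg_orders {r..T}) x \<longrightarrow>
        (\<exists>X. (\<forall>t\<in>{r..T}. solves_cdf_eq (demand_law M d r t) (critical_ratio c h b t) (s + X t)) \<and>
             (\<forall>t\<in>{r..T}. x t = second_stage_orders r X t)))"
proof -
  interpret two_stage_planning M T r c h b d X2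
    using assms(1) r demand c_end denom X2 X2_mono
    by (intro two_stage_planning.intro two_stage_planning_axioms.intro)
  have "is_arg_min (first_stage_cost M T r c h b d) (nonneg_orders {1..r-1}) (first_stage_orders X1) \<and>
     (\<forall>x. is_arg_min (first_stage_cost M T r c h b d) (nonneg_orders {1..r-1}) x \<longrightarrow>
        (\<exists>X. (\<forall>t\<in>{1..r-1}. solves_cdf_eq (demand_law M d 1 t) (critical_ratio c h b t) (X t)) \<and>
             (\<forall>t\<in>{1..r-1}. x t = first_stage_orders X t)))"
  proof (cases "r = 1")
    case True
    then show ?thesis
      using single_stage_first_cost[of M T c h b d]
      by (auto simp: is_arg_min_linorder nonneg_orders_def intro: order_eq_refl)
  next
    case False
    then have "1 < r" using r by simp
    note stage1 = \<open>1 < r\<close> X1 X1_nonneg[OF \<open>1 < r\<close>] X1_mono X2_nonneg[OF \<open>1 < r\<close>]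
    have "is_arg_min (first_stage_cost M T r c h b d) (nonneg_orders {1..r-1}) (first_stage_orders X1)"
      using stage1 by (rule first_stage_orders_optimal)
    moreover have "\<exists>X. (\<forall>t\<in>{1..r-1}. solves_cdf_eq (demand_law M d 1 t) (critical_ratio c h b t) (X t)) \<and>
        (\<forall>t\<in>{1..r-1}. x t = first_stage_orders X t)"
      if "is_arg_min (first_stage_cost M T r c h b d) (nonneg_orders {1..r-1}) x" for x
      using stage1 that by (rule first_stage_optimal_is_order_up_to)
    ultimately show ?thesis by blast
  qed
  moreover have "is_arg_min (second_stage_cost M T r c h b d s) (nonneg_orders {r..T})
      (second_stage_orders r (X2 s))" for s
    using X2_solves X2_mono by (rule second.second_stage_orders_optimal)
  moreover have "\<exists>X. (\<forall>t\<in>{r..T}. solves_cdf_eq (demand_law M d r t) (critical_ratio c h b t) (s + X t)) \<and>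
      (\<forall>t\<in>{r..T}. x t = second_stage_orders r X t)"
    if "is_arg_min (second_stage_cost M T r c h b d s) (nonneg_orders {r..T}) x" for s x
    using X2_solves X2_mono that unfolding second.solves_level_def[symmetric]
    by (rule second.second_stage_optimal_is_order_up_to)
  ultimately show ?thesis by blast
qed

end
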